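(* Let $\mathcal X$ be a finite nonempty set of states, and let an imprecise Markov chain on $\mathcal X$ be given by an initial upper expectation functional $\overline E_0$ and an upper transition operator $\overline T$, with corresponding lower expectation functional $\underline E_0$ and lower transition operator $\underline T$. For $n\in\mathbb N\cup\{0\}$ put $\overline E_n=\overline E_0\overline T^n$, $\underline E_n=\underline E_0\underline T^n$, $I_n=d(\overline E_n,\underline E_n)$, $\hat I=d(\overline T,\underline T)$ and $\rho_n=\rho(\overline T^n)$. Then for every $n\in\mathbb N\cup\{0\}$, $$I_n\le I_0\,\rho_n+\hat I\sum_{i=0}^{n-1}\rho_i .$$
   Context: $\mathcal L(\mathcal X)$ is the space of all maps $f:\mathcal X\to\mathbb R$, and $\mathcal L_1=\{f\in\mathcal L(\mathcal X): 0\le f(x)\le 1\ \forall x\in\mathcal X\}$. An expectation functional is a map $E(f)=\sum_{x}p(x)f(x)$ with $p$ a probability mass function on $\mathcal X$. A credal set is a nonempty closed convex set $\mathcal M$ of expectation functionals; its upper and lower expectation functionals are $\overline E(f)=\max_{E\in\mathcal M}E(f)$ and $\underline E(f)=\min_{E\in\mathcal M}E(f)=-\overline E(-f)$. An upper transition operator is a map $\overline T:\mathcal L(\mathcal X)\to\mathcal L(\mathcal X)$, $\overline Tf(x)=\overline T(f|x)$, where for each $x\in\mathcal X$ the functional $\overline T(\cdot|x)$ is an upper expectation functional; the corresponding lower transition operator is $\underline Tf=-\overline T(-f)$, with rows $\underline T(\cdot|x)$. Products denote composition, $\overline T^0=\underline T^0$ is the identity, and $(\overline E\,\overline T^n)(f)=\overline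 E(\overline T^nf)$, etc. Distances: $d(\overline E_1,\overline E_2)=\max_{f\in\mathcal L_1}|\overline E_1(f)-\overline E_2(f)|$ for two upper expectation functionals; $d(\overline E_1,\underline E_2)=\max_{f\in\mathcal L_1}\big(\overline E_1(f)-\underline E_2(f)\big)$ for an upper and a lower expectation functional; $d(\overline T,\underline T)=\max_{x\in\mathcal X}d(\overline T(\cdot|x),\underline T(\cdot|x))$. Weak coefficient of ergodicity: $\rho(\overline T)=\max_{x,y\in\mathcal X}d(\overline T(\cdot|x),\overline T(\cdot|y))$. Empty sums are $0$. *)

theory Defs
  imports "HOL-Probability.Probability"
begin

type_synonym 'x gamble = "'x \<Rightarrow> real"
type_synonym 'x functional = "'x gamble \<Rightarrow> real"
type_synonym 'x operator = "'x gamble \<Rightarrow> 'x gamble"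

definition L1 :: "'x gamble set" where
  "L1 = {f. \<forall>x. 0 \<le> f x \<and> f x \<le> 1}"

definition expectation_functional :: "('x::finite) functional \<Rightarrow> bool" where
  "expectation_functional E \<longleftrightarrow> (\<exists>p :: 'x pmf. E = (\<lambda>f. \<Sum>x\<in>UNIV. pmf p x * f x))"

text \<open>
  Closedness refers to the topology of pointwise convergence on functionals. On expectation
  functionals over a finite set it agrees with the Euclidean topology on the mass functions
  (and the expectation functionals form a compact set, see \<open>compact_expectation_functionals\<close>
  below). Convexity is spelled out because functions are not an instance of \<open>real_vector\<close>.
\<close>

definition credal_set :: "('x::finite) functional set \<Rightarrow> bool" where
  "credal_set M \<longleftrightarrow>
     M \<noteq> {} \<and> closed M \<and>
     (\<forall>E\<in>M. \<forall>E'\<in>M. \<forall>t\<in>{0..1}. (\<lambda>f. (1 - t) * E f + t * E' f) \<in> M) \<and>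
     (\<forall>E\<in>M. expectation_functional E)"

text \<open>
  The suprema below are maxima: see \<open>upper_envelope_attained\<close>,
  \<open>dist_upper_upper_attained\<close> and \<open>dist_upper_lower_attained\<close>.
\<close>

definition upper_envelope :: "'x functional set \<Rightarrow> 'x functional" where
  "upper_envelope M f = (SUP E\<in>M. E f)"

definition upper_expectation :: "('x::finite) functional \<Rightarrow> bool" where
  "upper_expectation E \<longleftrightarrow> (\<exists>M. credal_set M \<and> E = upper_envelope M)"

text \<open>
  The lower functional is determined by the upper one through conjugacy; that it is the
  minimum over the credal set is \<open>lower_functional_attained\<close>.
\<close>

definition lower_functional :: "'x functional \<Rightarrow> 'x functional" where
  "lower_functional E f = - E (\<lambda>x. - f x)"

definition op_row :: "'x operator \<Rightarrow> 'x \<Rightarrow> 'x functional" where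
  "op_row T x = (\<lambda>f. T f x)"

definition upper_transition_operator :: "('x::finite) operator \<Rightarrow> bool" where
  "upper_transition_operator T \<longleftrightarrow> (\<forall>x. upper_expectation (op_row T x))"

definition lower_operator :: "'x operator \<Rightarrow> 'x operator" where
  "lower_operator T f = (\<lambda>x. - T (\<lambda>y. - f y) x)"

definition dist_upper_upper :: "'x functional \<Rightarrow> 'x functional \<Rightarrow> real" where
  "dist_upper_upper E1 E2 = (SUP f\<in>L1. \<bar>E1 f - E2 f\<bar>)"

definition dist_upper_lower :: "'x functional \<Rightarrow> 'x functional \<Rightarrow> real" where
  "dist_upper_lower E1 E2 = (SUP f\<in>L1. E1 f - E2 f)"

definition dist_operator :: "('x::finite) operator \<Rightarrow> 'x operator \<Rightarrow> real" where
  "dist_operator T1 T2 = (MAX x. dist_upper_lower (op_row T1 x) (op_row T2 x))"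

definition weak_ergodicity_coeff :: "('x::finite) operator \<Rightarrow> real" where
  "weak_ergodicity_coeff T = (MAX x. MAX y. dist_upper_upper (op_row T x) (op_row T y))"

definition upper_at :: "'x functional \<Rightarrow> 'x operator \<Rightarrow> nat \<Rightarrow> 'x functional" where
  "upper_at E0 T n = E0 \<circ> (T ^^ n)"

definition lower_at :: "'x functional \<Rightarrow> 'x operator \<Rightarrow> nat \<Rightarrow> 'x functional" where
  "lower_at E0 T n = lower_functional E0 \<circ> (lower_operator T ^^ n)"

definition imprecision :: "'x functional \<Rightarrow> 'x operator \<Rightarrow> nat \<Rightarrow> real" where
  "imprecision E0 T n = dist_upper_lower (upper_at E0 T n) (lower_at E0 T n)"


lemma op_row_lower_operator: "op_row (lower_operator T) x = lower_functional (op_row T x)"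
  by (rule ext) (simp add: op_row_def lower_operator_def lower_functional_def)

lemma compact_box_fun: "compact {f :: 'x::finite \<Rightarrow> real. \<forall>x. 0 \<le> f x \<and> f x \<le> 1}"
proof -
  have "compactin (product_topology (\<lambda>_::'x. euclidean) UNIV) (PiE UNIV (\<lambda>_. {0..1::real}))"
    unfolding compactin_PiE by auto
  moreover have "PiE UNIV (\<lambda>_. {0..1}) = {f :: 'x \<Rightarrow> real. \<forall>x. 0 \<le> f x \<and> f x \<le> 1}"
    by (auto simp: PiE_def Pi_def)
  ultimately show ?thesis
    by (simp add: euclidean_product_topology)
qed

lemma compact_L1: "compact (L1 :: ('x::finite) gamble set)"
  unfolding L1_def by (rule compact_box_fun)

lemma compact_expectation_functionals:
  "compact {E :: ('x::finite) functional. expectation_functional E}"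
proof -
  let ?S = "{p :: 'x \<Rightarrow> real. \<forall>x. 0 \<le> p x \<and> p x \<le> 1} \<inter> {p. (\<Sum>x\<in>UNIV. p x) = 1}"
  let ?F = "\<lambda>(p::'x \<Rightarrow> real) (f::'x \<Rightarrow> real). \<Sum>x\<in>UNIV. p x * f x"
  have "closed {p :: 'x \<Rightarrow> real. (\<Sum>x\<in>UNIV. p x) = 1}"
    by (intro closed_Collect_eq continuous_intros continuous_on_product_coordinates)
  then have "compact ?S" by (intro compact_Int_closed compact_box_fun)
  moreover have "continuous_on ?S ?F"
    by (intro continuous_on_coordinatewise_then_product continuous_intros
        continuous_on_subset[OF continuous_on_product_coordinates]) auto
  ultimately have "compact (?F ` ?S)" by (rule compact_continuous_image[rotated])
  moreover have "?F ` ?S = {E. expectation_functional E}"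
  proof (intro equalityI subsetI)
    fix E assume "E \<in> ?F ` ?S"
    then obtain p where p: "\<forall>x. 0 \<le> p x" "(\<Sum>x\<in>UNIV. p x) = 1" "E = ?F p" by auto
    have "(\<integral>\<^sup>+ x. ennreal (p x) \<partial>count_space UNIV) = ennreal (\<Sum>x\<in>UNIV. p x)"
      using p(1) by (simp add: nn_integral_count_space_finite)
    then have "pmf (embed_pmf p) x = p x" for x
      using p by (intro pmf_embed_pmf) auto
    then show "E \<in> {E. expectation_functional E}"
      using p(3) unfolding expectation_functional_def by (auto intro!: exI[of _ "embed_pmf p"])
  next
    fix E :: "'x functional" assume "E \<in> {E. expectation_functional E}"
    then obtain p :: "'x pmf" where "E = ?F (pmf p)" unfolding expectation_functional_def by auto
    moreover have "pmf p \<in> ?S" using sum_pmf_eq_1[of UNIV p] by (simp add: pmf_le_1)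
    ultimately show "E \<in> ?F ` ?S" by blast
  qed
  ultimately show ?thesis by simp
qed

lemma credal_set_compact: "credal_set M \<Longrightarrow> compact M"
  using compact_Int_closed[OF compact_expectation_functionals, of M]
  by (simp add: credal_set_def Int_absorb1 subset_iff)

lemma upper_envelope_attained:
  assumes "credal_set M"
  shows "\<exists>E\<in>M. upper_envelope M f = E f" "E \<in> M \<Longrightarrow> E f \<le> upper_envelope M f"
proof -
  have "continuous_on M (\<lambda>E. E f)"
    by (rule continuous_on_subset[OF continuous_on_product_coordinates]) auto
  from continuous_attains_sup[OF credal_set_compact[OF assms] _ this] assms
  obtain E where E: "E \<in> M" "\<forall>E'\<in>M. E' f \<le> E f" by (auto simp: credal_set_def)
  have "upper_envelope M f = E f"
    unfolding upper_envelope_def using E by (intro cSup_eq_maximum) auto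
  then show "\<exists>E\<in>M. upper_envelope M f = E f" "E' \<in> M \<Longrightarrow> E' f \<le> upper_envelope M f" for E'
    using E by auto
qed

lemma expectation_functional_uminus:
  "expectation_functional E \<Longrightarrow> E (\<lambda>x. - f x) = - E f"
  by (auto simp: expectation_functional_def sum_negf)

lemma lower_functional_attained:
  assumes "credal_set M"
  shows "\<exists>E\<in>M. lower_functional (upper_envelope M) f = E f"
    and "E \<in> M \<Longrightarrow> lower_functional (upper_envelope M) f \<le> E f"
  using upper_envelope_attained[OF assms, where f = "\<lambda>x. - f x"] assms
  by (auto simp: lower_functional_def credal_set_def expectation_functional_uminus)

lemma upper_expectation_diff_le:
  assumes "upper_expectation E"
  shows "E f - E g \<le> (\<Sum>x\<in>UNIV. \<bar>f x - g x\<bar>)"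
proof -
  obtain M where M: "credal_set M" "E = upper_envelope M"
    using assms by (auto simp: upper_expectation_def)
  obtain e where e: "e \<in> M" "E f = e f" using upper_envelope_attained(1)[OF M(1)] M(2) by auto
  then obtain p :: "'a pmf" where p: "e = (\<lambda>f. \<Sum>x\<in>UNIV. pmf p x * f x)"
    using M(1) e(1) unfolding credal_set_def expectation_functional_def by blast
  have "E f - E g \<le> e f - e g" using upper_envelope_attained(2)[OF M(1) e(1)] e(2) M(2) by auto
  also have "\<dots> = (\<Sum>x\<in>UNIV. pmf p x * (f x - g x))"
    by (simp add: p sum_subtractf algebra_simps)
  also have "\<dots> \<le> (\<Sum>x\<in>UNIV. \<bar>f x - g x\<bar>)"
  proof (rule sum_mono)
    fix x
    have "pmf p x * (f x - g x) \<le> pmf p x * \<bar>f x - g x\<bar>" by (intro mult_left_mono) auto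
    also have "\<dots> \<le> 1 * \<bar>f x - g x\<bar>" by (intro mult_right_mono pmf_le_1) auto
    finally show "pmf p x * (f x - g x) \<le> \<bar>f x - g x\<bar>" by simp
  qed
  finally show ?thesis .
qed

lemma upper_expectation_continuous:
  assumes "upper_expectation E"
  shows "continuous_on UNIV E"
  unfolding continuous_on_def
proof
  fix g :: "'a gamble"
  have "continuous_on UNIV (\<lambda>f. \<Sum>x\<in>UNIV. \<bar>f x - g x\<bar>)"
    by (intro continuous_intros continuous_on_product_coordinates)
  then have "((\<lambda>f. \<Sum>x\<in>UNIV. \<bar>f x - g x\<bar>) \<longlongrightarrow> 0) (at g)"
    unfolding continuous_on_def by (drule_tac bspec[of _ _ g]) simp_all
  moreover have "\<bar>E f - E g\<bar> \<le> (\<Sum>x\<in>UNIV. \<bar>f x - g x\<bar>)" for f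
    using upper_expectation_diff_le[OF assms, of f g] upper_expectation_diff_le[OF assms, of g f]
    by (simp add: abs_minus_commute)
  ultimately have "((\<lambda>f. E f - E g) \<longlongrightarrow> 0) (at g)"
    by (intro Lim_null_comparison[of "\<lambda>f. E f - E g" "\<lambda>f. \<Sum>x\<in>UNIV. \<bar>f x - g x\<bar>"]) auto
  then show "(E \<longlongrightarrow> E g) (at g within UNIV)" by (simp add: LIM_zero_iff)
qed

lemma lower_functional_continuous:
  assumes "upper_expectation E"
  shows "continuous_on UNIV (lower_functional E)"
  unfolding lower_functional_def
  by (intro continuous_intros continuous_on_compose2[OF upper_expectation_continuous[OF assms]]
      continuous_on_coordinatewise_then_product continuous_on_product_coordinates) auto

lemma upper_at_continuous:
  assumes "upper_expectation E" "upper_transition_operator T"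
  shows "continuous_on UNIV (upper_at E T n)"
proof -
  have T: "continuous_on UNIV T"
    using assms(2) upper_expectation_continuous unfolding upper_transition_operator_def op_row_def
    by (intro continuous_on_coordinatewise_then_product) blast
  have "continuous_on UNIV (T ^^ n)"
    by (induction n) (auto simp: id_def comp_def intro!: continuous_on_compose2[OF T])
  then show ?thesis unfolding upper_at_def
    by (intro continuous_on_compose continuous_on_subset[OF upper_expectation_continuous[OF assms(1)]])
      auto
qed

lemma lower_at_continuous:
  assumes "upper_expectation E" "upper_transition_operator T"
  shows "continuous_on UNIV (lower_at E T n)"
proof -
  have "continuous_on UNIV (\<lambda>f. lower_operator T f x)" for x
    using assms(2) lower_functional_continuous[of "op_row T x"]
    by (simp add: upper_transition_operator_def flip: op_row_lower_operator)
      (simp add: op_row_def)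
  then have T: "continuous_on UNIV (lower_operator T)"
    by (intro continuous_on_coordinatewise_then_product) blast
  have "continuous_on UNIV (lower_operator T ^^ n)"
    by (induction n) (auto simp: id_def comp_def intro!: continuous_on_compose2[OF T])
  then show ?thesis unfolding lower_at_def
    by (intro continuous_on_compose continuous_on_subset[OF lower_functional_continuous[OF assms(1)]])
      auto
qed

lemma op_row_power_continuous:
  assumes "upper_transition_operator T"
  shows "continuous_on UNIV (op_row (T ^^ n) x)"
proof (cases n)
  case 0
  then show ?thesis by (simp add: op_row_def)
next
  case (Suc m)
  have "op_row (T ^^ n) x = upper_at (op_row T x) T m"
    by (simp add: Suc op_row_def upper_at_def comp_def)
  then show ?thesis
    using assms upper_at_continuous[of "op_row T x" T m]
    by (simp add: upper_transition_operator_def)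
qed

lemma SUP_L1_attained:
  fixes \<phi> :: "('x::finite) gamble \<Rightarrow> real"
  assumes "continuous_on UNIV \<phi>"
  shows "\<exists>f\<in>L1. (SUP f\<in>L1. \<phi> f) = \<phi> f" "g \<in> L1 \<Longrightarrow> \<phi> g \<le> (SUP f\<in>L1. \<phi> f)"
proof -
  have "(\<lambda>_. 0) \<in> (L1 :: 'x gamble set)" by (simp add: L1_def)
  then have "L1 \<noteq> ({} :: 'x gamble set)" by blast
  from continuous_attains_sup[OF compact_L1 this continuous_on_subset[OF assms]]
  obtain f where f: "f \<in> L1" "\<forall>g\<in>L1. \<phi> g \<le> \<phi> f" by auto
  have "(SUP f\<in>L1. \<phi> f) = \<phi> f" using f by (intro cSup_eq_maximum) auto
  then show "\<exists>f\<in>L1. (SUP f\<in>L1. \<phi> f) = \<phi> f" "g \<in> L1 \<Longrightarrow> \<phi> g \<le> (SUP f\<in>L1. \<phi> f)" for g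
    using f by auto
qed

lemma dist_upper_upper_attained:
  fixes E1 E2 :: "('x::finite) functional"
  assumes "continuous_on UNIV E1" "continuous_on UNIV E2"
  shows "\<exists>f\<in>L1. dist_upper_upper E1 E2 = \<bar>E1 f - E2 f\<bar>"
    and "g \<in> L1 \<Longrightarrow> \<bar>E1 g - E2 g\<bar> \<le> dist_upper_upper E1 E2"
proof -
  have "continuous_on UNIV (\<lambda>f. \<bar>E1 f - E2 f\<bar>)"
    using assms by (intro continuous_intros)
  from SUP_L1_attained[OF this]
  show "\<exists>f\<in>L1. dist_upper_upper E1 E2 = \<bar>E1 f - E2 f\<bar>"
    and "g \<in> L1 \<Longrightarrow> \<bar>E1 g - E2 g\<bar> \<le> dist_upper_upper E1 E2" for g
    unfolding dist_upper_upper_def by auto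
qed

lemma dist_upper_lower_attained:
  fixes E1 E2 :: "('x::finite) functional"
  assumes "continuous_on UNIV E1" "continuous_on UNIV E2"
  shows "\<exists>f\<in>L1. dist_upper_lower E1 E2 = E1 f - E2 f"
    and "g \<in> L1 \<Longrightarrow> E1 g - E2 g \<le> dist_upper_lower E1 E2"
proof -
  have "continuous_on UNIV (\<lambda>f. E1 f - E2 f)"
    using assms by (intro continuous_intros)
  from SUP_L1_attained[OF this]
  show "\<exists>f\<in>L1. dist_upper_lower E1 E2 = E1 f - E2 f"
    and "g \<in> L1 \<Longrightarrow> E1 g - E2 g \<le> dist_upper_lower E1 E2" for g
    unfolding dist_upper_lower_def by auto
qed

end

theory Submission
  imports Defs
begin

text \<open>
  The imprecision of a functional at a gamble is the gap between its upper and its lower value.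
  Upper expectations commute with adding a constant and with nonnegative scaling, so a gamble
  that varies by at most \<open>r\<close> is a constant plus \<open>r\<close> times a gamble in \<^const>\<open>L1\<close>; the gap
  at such a gamble is therefore at most \<open>r\<close> times the distance between the upper and the lower
  functional (\<open>upper_lower_gap_le\<close>). For \<open>f\<close> in \<^const>\<open>L1\<close>, the gamble \<open>(T ^^ i) f\<close> varies by
  at most \<open>\<rho>\<^sub>i\<close>, the ergodicity coefficient of \<open>T ^^ i\<close> (\<open>power_variation_le\<close>). So exchanging
  the upper for the lower operator costs at most \<open>I * \<rho>\<^sub>i\<close>, where \<open>I\<close> is the distance between
  the two operators, when it is done on top of \<open>T ^^ i\<close>, and exchanging the
  initial upper for the initial lower functional costs at most \<open>I\<^sub>0 * \<rho>\<^sub>n\<close> on top of \<open>T ^^ n\<close>,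
  where \<open>I\<^sub>0\<close> is the initial imprecision.

  The exchanges are made one at a time. Each of them happens below further lower operators, but
  a lower operator is monotone and passes constants through, so an error that is bounded
  uniformly in the state is not amplified, and the costs add up
  (\<open>upper_power_le_lower_power\<close>).
\<close>

section \<open>Monotonicity and affinity of upper and lower expectations\<close>

lemma expectation_functional_affine:
  assumes "expectation_functional E"
  shows "E (\<lambda>x. c + r * f x) = c + r * E f"
proof -
  obtain p where p: "E = (\<lambda>f. \<Sum>x\<in>UNIV. pmf p x * f x)"
    using assms by (auto simp: expectation_functional_def)
  have "E (\<lambda>x. c + r * f x) = (\<Sum>x\<in>UNIV. pmf p x) * c + r * E f"
    unfolding p sum_distrib_right sum_distrib_left sum.distrib[symmetric]
    by (intro sum.cong) (auto simp: algebra_simps)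
  then show ?thesis by (simp add: sum_pmf_eq_1)
qed

lemma expectation_functional_mono:
  assumes "expectation_functional E" "\<And>x. f x \<le> g x"
  shows "E f \<le> E g"
  using assms by (auto simp: expectation_functional_def intro!: sum_mono mult_left_mono)

lemma upper_expectation_mono:
  assumes "upper_expectation E" "\<And>x. f x \<le> g x"
  shows "E f \<le> E g"
proof -
  obtain M where M: "credal_set M" "E = upper_envelope M"
    using assms(1) by (auto simp: upper_expectation_def)
  obtain e where e: "e \<in> M" "E f = e f"
    using upper_envelope_attained(1)[OF M(1)] M(2) by auto
  have "e f \<le> e g"
    using M(1) e(1) assms(2) by (auto simp: credal_set_def intro: expectation_functional_mono)
  also have "\<dots> \<le> E g" using upper_envelope_attained(2)[OF M(1) e(1)] M(2) by simp
  finally show ?thesis using e(2) by simp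
qed

lemma upper_expectation_affine:
  assumes "upper_expectation E" "0 \<le> r"
  shows "E (\<lambda>x. c + r * f x) = c + r * E f"
proof -
  obtain M where M: "credal_set M" "E = upper_envelope M"
    using assms(1) by (auto simp: upper_expectation_def)
  have aff: "e (\<lambda>x. c + r * f x) = c + r * e f" if "e \<in> M" for e
    using M(1) that by (auto simp: credal_set_def intro: expectation_functional_affine)
  have le: "e g \<le> E g" if "e \<in> M" for e g
    using upper_envelope_attained(2)[OF M(1) that] M(2) by simp
  obtain e where e: "e \<in> M" "E (\<lambda>x. c + r * f x) = e (\<lambda>x. c + r * f x)"
    using upper_envelope_attained(1)[OF M(1)] M(2) by blast
  obtain e' where e': "e' \<in> M" "E f = e' f"
    using upper_envelope_attained(1)[OF M(1)] M(2) by blast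
  show ?thesis
  proof (rule antisym)
    show "E (\<lambda>x. c + r * f x) \<le> c + r * E f"
      unfolding e(2) aff[OF e(1)] using mult_left_mono[OF le[OF e(1), of f] assms(2)] by simp
    show "c + r * E f \<le> E (\<lambda>x. c + r * f x)"
      unfolding e'(2) using le[OF e'(1), of "\<lambda>x. c + r * f x"] aff[OF e'(1)] by linarith
  qed
qed

lemma lower_functional_affine:
  assumes "upper_expectation E" "0 \<le> r"
  shows "lower_functional E (\<lambda>x. c + r * f x) = c + r * lower_functional E f"
  using upper_expectation_affine[OF assms, of "- c" "\<lambda>x. - f x"]
  by (simp add: lower_functional_def algebra_simps)

text \<open>
  The uniform error \<open>c\<close> is not enlarged by a lower expectation; this is what keeps the costs of
  successive exchanges additive.
\<close>

lemma lower_functional_mono_shift: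
  assumes "upper_expectation E" "\<And>x. f x \<le> c + g x"
  shows "lower_functional E f \<le> c + lower_functional E g"
proof -
  have "lower_functional E f \<le> lower_functional E (\<lambda>x. c + 1 * g x)"
    unfolding lower_functional_def neg_le_iff_le
    by (rule upper_expectation_mono[OF assms(1)]) (simp only: neg_le_iff_le mult_1 assms(2))
  also have "\<dots> = c + lower_functional E g"
    using lower_functional_affine[OF assms(1), of 1 c g] by simp
  finally show ?thesis .
qed

section \<open>The gap between upper and lower expectations\<close>

lemma upper_lower_gap_le:
  assumes E: "upper_expectation E"
    and var: "\<And>x y. g x - g y \<le> r"
  shows "E g \<le> lower_functional E g + dist_upper_lower E (lower_functional E) * r"
proof -
  have r: "0 \<le> r" using var[of undefined undefined] by simp
  define c where "c = Min (range g)"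
  define h where "h = (\<lambda>x. (g x - c) / r)"
  have c_le: "c \<le> g x" for x unfolding c_def by simp
  have "c \<in> range g" unfolding c_def by (intro Min_in) auto
  then have le_r: "g x - c \<le> r" for x using var by auto
  \<comment> \<open>For \<open>r = 0\<close> the gamble is constant and \<open>h\<close> is \<open>0\<close>, so the normalisation needs no case
    split below.\<close>
  have g: "g = (\<lambda>x. c + r * h x)"
  proof
    fix x
    show "g x = c + r * h x"
      using c_le[of x] le_r[of x] by (cases "r = 0") (auto simp: h_def)
  qed
  have "h \<in> L1"
    using c_le le_r r by (auto simp: h_def L1_def divide_le_eq_1)
  then have "E h - lower_functional E h \<le> dist_upper_lower E (lower_functional E)"
    by (rule dist_upper_lower_attained(2)
        [OF upper_expectation_continuous[OF E] lower_functional_continuous[OF E]])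
  then have "(E h - lower_functional E h) * r \<le> dist_upper_lower E (lower_functional E) * r"
    using r by (rule mult_right_mono)
  then show ?thesis
    unfolding g upper_expectation_affine[OF E r] lower_functional_affine[OF E r]
    by (simp add: algebra_simps)
qed

section \<open>Powers of the transition operators\<close>

lemma power_variation_le:
  assumes "upper_transition_operator T" "f \<in> L1"
  shows "(T ^^ n) f x - (T ^^ n) f y \<le> weak_ergodicity_coeff (T ^^ n)"
proof -
  let ?d = "\<lambda>x y. dist_upper_upper (op_row (T ^^ n) x) (op_row (T ^^ n) y)"
  have "(T ^^ n) f x - (T ^^ n) f y \<le> ?d x y"
    using dist_upper_upper_attained(2)[OF op_row_power_continuous[OF assms(1), of n x]
        op_row_power_continuous[OF assms(1), of n y] assms(2)]
    by (simp add: op_row_def)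
  also have "\<dots> \<le> (MAX y. ?d x y)" by (rule Max_ge) auto
  also have "\<dots> \<le> (MAX x. MAX y. ?d x y)" by (rule Max_ge) auto
  finally show ?thesis by (simp add: weak_ergodicity_coeff_def)
qed

lemma upper_operator_gap_le:
  assumes T: "upper_transition_operator T"
    and var: "\<And>x y. g x - g y \<le> r"
  shows "T g x \<le> lower_operator T g x + dist_operator T (lower_operator T) * r"
proof -
  let ?d = "\<lambda>x. dist_upper_lower (op_row T x) (op_row (lower_operator T) x)"
  have r: "0 \<le> r" using var[of x x] by simp
  have row: "upper_expectation (op_row T x)"
    using T by (simp add: upper_transition_operator_def)
  have "T g x \<le> lower_operator T g x + ?d x * r"
    using upper_lower_gap_le[OF row var]
    by (simp add: op_row_lower_operator[symmetric]) (simp add: op_row_def)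
  also have "?d x * r \<le> dist_operator T (lower_operator T) * r"
    unfolding dist_operator_def using r by (intro mult_right_mono Max_ge) auto
  finally show ?thesis by simp
qed

text \<open>
  In the induction step the new exchange is the outermost one. It acts on \<open>(T ^^ n) f\<close>, whose
  variation is controlled by the coefficient of \<open>T ^^ n\<close>; the error made inside passes unchanged
  through the lower operator that results.
\<close>

lemma upper_power_le_lower_power:
  assumes T: "upper_transition_operator T" and f: "f \<in> L1"
  shows "(T ^^ n) f x
    \<le> dist_operator T (lower_operator T) * (\<Sum>i<n. weak_ergodicity_coeff (T ^^ i))
      + (lower_operator T ^^ n) f x"
proof (induction n arbitrary: x)
  case 0
  then show ?case by simp
next
  case (Suc n)
  let ?I = "dist_operator T (lower_operator T)"
  let ?c = "?I * (\<Sum>i<n. weak_ergodicity_coeff (T ^^ i))"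
  have row: "upper_expectation (op_row T x)"
    using T by (simp add: upper_transition_operator_def)
  have "T ((T ^^ n) f) x
      \<le> lower_operator T ((T ^^ n) f) x + ?I * weak_ergodicity_coeff (T ^^ n)"
    by (intro upper_operator_gap_le[OF T] power_variation_le[OF T f])
  also have "lower_operator T ((T ^^ n) f) x
      \<le> ?c + lower_operator T ((lower_operator T ^^ n) f) x"
    using lower_functional_mono_shift[OF row Suc.IH]
    by (simp add: op_row_lower_operator[symmetric]) (simp add: op_row_def)
  finally show ?case by (simp add: algebra_simps)
qed

section \<open>The bound on the imprecision\<close>

theorem theorem3:
  fixes E0 :: "('x::finite \<Rightarrow> real) \<Rightarrow> real"
    and T :: "('x \<Rightarrow> real) \<Rightarrow> ('x \<Rightarrow> real)"
    and n :: nat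
  assumes "upper_expectation E0"
    and "upper_transition_operator T"
  shows "imprecision E0 T n
    \<le> imprecision E0 T 0 * weak_ergodicity_coeff (T ^^ n)
      + dist_operator T (lower_operator T) * (\<Sum>i<n. weak_ergodicity_coeff (T ^^ i))"
proof -
  let ?c = "dist_operator T (lower_operator T) * (\<Sum>i<n. weak_ergodicity_coeff (T ^^ i))"
  have I0: "imprecision E0 T 0 = dist_upper_lower E0 (lower_functional E0)"
    unfolding imprecision_def upper_at_def lower_at_def funpow.simps(1) o_id ..
  obtain f where f: "f \<in> L1" "imprecision E0 T n = upper_at E0 T n f - lower_at E0 T n f"
    unfolding imprecision_def
    by (rule bexE[OF dist_upper_lower_attained(1)[OF upper_at_continuous[OF assms]
        lower_at_continuous[OF assms]]])
  have "E0 ((T ^^ n) f) \<le> lower_functional E0 ((T ^^ n) f)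
      + imprecision E0 T 0 * weak_ergodicity_coeff (T ^^ n)"
    unfolding I0
    by (intro upper_lower_gap_le[OF assms(1)] power_variation_le[OF assms(2) f(1)])
  also have "lower_functional E0 ((T ^^ n) f)
      \<le> ?c + lower_functional E0 ((lower_operator T ^^ n) f)"
    by (intro lower_functional_mono_shift[OF assms(1)]
        upper_power_le_lower_power[OF assms(2) f(1)])
  finally show ?thesis
    unfolding f(2) by (simp add: upper_at_def lower_at_def)
qed

end
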